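(* Let $N\ge 2$, let $\mathbb{D}$ be a division ring, let $\mu_1$ be a $\mathbb{D}^\times$-valued function of the variable $n_\sigma=n_1+\dots+n_N$, and let $r_1,\dots,r_K:\mathbb{Z}^N\to\mathbb{D}^\times$ be a solution of the non-isospectral lattice modified Gel'fand--Dikii system $$(r_{k(j)}^{-1}-r_{k(i)}^{-1})\,r_{k(ij)} = r_{k+1}^{-1}(r_{k+1(i)}-r_{k+1(j)}),\quad k=1,\dots,K-1,$$ $$(r_{K(j)}^{-1}-r_{K(i)}^{-1})\,r_{K(ij)} = \mu_1^{-1}r_{1}^{-1}(r_{1(i)}-r_{1(j)})\,\mu_{1(\sigma)},\qquad 1\le i\neq j\le N.$$ If $\mathbb{D}$ is commutative, then the function $R=r_1r_2\cdots r_K$ splits into the product of functions of the single variables $n_i$, $i=1,\dots,N$, and a function of the sum of the independent variables: there exist functions $R_1,\dots,R_N,m:\mathbb{Z}\to\mathbb{D}^\times$ such that $R(n_1,\dots,n_N)=R_1(n_1)\cdots R_N(n_N)\,m(n_1+\dots+n_N)$ for all $(n_1,\dots,n_N)\in\mathbb{Z}^N$.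
   Context: For a function $f$ on $\mathbb{Z}^N$, $f_{(i)}$ denotes its translate in the variable $n_i\mapsto n_i+1$, and $f_{(ij)}=(f_{(i)})_{(j)}$. For a function $g$ of $n_\sigma=n_1+\dots+n_N$, $g_{(\sigma)}(n_\sigma)=g(n_\sigma+1)$. $\mathbb{D}^\times=\mathbb{D}\setminus\{0\}$.
   Formalization: Adds the genericity assumption that for every lattice point and every i ≠ j, r_{k(i)} ≠ r_{k(j)} for some k; without it the claim fails, since equations of the form 0=0 leave r_{k(ij)} unconstrained. *)

theory Defs
  imports "HOL-Analysis.Analysis"
begin

text \<open>The lattice \<open>\<int>\<^sup>N\<close> is \<^typ>\<open>int ^ 'n\<close> with \<open>N = CARD('n)\<close>. Only the values
  \<open>r k\<close> with \<open>1 \<le> k \<le> K\<close> are meaningful.\<close>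

definition translate :: "'n::finite \<Rightarrow> (int ^ 'n \<Rightarrow> 'a) \<Rightarrow> (int ^ 'n \<Rightarrow> 'a)" where
  "translate i f = (\<lambda>n. f (n + axis i 1))"

definition nsigma :: "int ^ 'n::finite \<Rightarrow> int" where
  "nsigma n = (\<Sum>i\<in>UNIV. n $ i)"

definition nonisospectral_lmGD ::
  "nat \<Rightarrow> (int \<Rightarrow> 'a::division_ring) \<Rightarrow> (nat \<Rightarrow> int ^ 'n::finite \<Rightarrow> 'a) \<Rightarrow> bool" where
  "nonisospectral_lmGD K \<mu>\<^sub>1 r \<longleftrightarrow>
    (\<forall>i j n. i \<noteq> j \<longrightarrow>
      (\<forall>k\<in>{1..<K}.
        (inverse (translate j (r k) n) - inverse (translate i (r k) n))
            * translate j (translate i (r k)) n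
          = inverse (r (k + 1) n) * (translate i (r (k + 1)) n - translate j (r (k + 1)) n)) \<and>
      (inverse (translate j (r K) n) - inverse (translate i (r K) n))
          * translate j (translate i (r K)) n
        = inverse (\<mu>\<^sub>1 (nsigma n)) * inverse (r 1 n)
            * (translate i (r 1) n - translate j (r 1) n) * \<mu>\<^sub>1 (nsigma n + 1))"

text \<open>Genericity: at no lattice point do all \<open>K\<close> equations of a pair \<open>i \<noteq> j\<close> degenerate to
  \<open>0 = 0\<close>. For nowhere vanishing solutions, if one of the differences below vanishes at \<open>n\<close>,
  then (going around the cyclic system) so do the differences for all \<open>k\<close>, and \<open>r k\<close> at the
  point translated in both directions is unconstrained by the equations at \<open>n\<close>; hence the
  existential quantifier is equivalent to a universal one. Without genericity the product of
  the \<open>r k\<close> need not split: for \<open>N = 2\<close>, \<open>K = 1\<close>, \<open>\<mu>\<^sub>1 = 1\<close> over the reals take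
  \<open>r 1 n = 2 powi ((n\<^sub>1 + n\<^sub>2 - 1) * (n\<^sub>1 - n\<^sub>2 + 1))\<close> if \<open>n\<^sub>1 + n\<^sub>2 \<ge> 1\<close> and \<open>r 1 n = 1\<close> otherwise.\<close>

definition nondegenerate :: "nat \<Rightarrow> (nat \<Rightarrow> int ^ 'n::finite \<Rightarrow> 'a) \<Rightarrow> bool" where
  "nondegenerate K r \<longleftrightarrow>
    (\<forall>i j n. i \<noteq> j \<longrightarrow> (\<exists>k\<in>{1..K}. translate i (r k) n \<noteq> translate j (r k) n))"

end

theory Submission
  imports Defs
begin

text \<open>Genericity forces all the differences \<open>r\<^sub>k\<^sub>(\<^sub>i\<^sub>) - r\<^sub>k\<^sub>(\<^sub>j\<^sub>)\<close> to be nonzero, so they cancel in the product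
  of the \<open>K\<close> equations around the cycle, leaving
  \<open>R\<^sub>(\<^sub>i\<^sub>j\<^sub>) R / (R\<^sub>(\<^sub>i\<^sub>) R\<^sub>(\<^sub>j\<^sub>)) = \<mu>\<^sub>1\<^sub>(\<^sub>\<sigma>\<^sub>) / \<mu>\<^sub>1\<close>. Dividing \<open>R\<close> by a function \<open>m\<close> of \<open>n\<^sub>\<sigma>\<close> with
  \<open>m\<^sub>(\<^sub>\<sigma>\<^sub>) = m \<mu>\<^sub>1\<close> turns the right-hand side into \<open>1\<close>; then \<open>R\<^sub>(\<^sub>i\<^sub>) / R\<close> is invariant under the shifts
  in all directions other than \<open>i\<close>, hence depends on \<open>n\<^sub>i\<close> only, and a multiplicative primitive of it
  serves as \<open>R\<^sub>i\<close>.\<close>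

text \<open>The recurrence from \<open>m 0 = 1\<close> multiplies by \<open>g\<close> going up and
  divides by it going down. For each \<open>s\<close> one of the two intervals in the witness is
  empty, so a single quotient covers both signs.\<close>

lemma exists_multiplicative_primitive:
  fixes g :: "int \<Rightarrow> 'a::field"
  assumes "\<And>s. g s \<noteq> 0"
  shows "\<exists>m. (\<forall>s. m s \<noteq> 0) \<and> (\<forall>s. m (s + 1) = m s * g s)"
proof (intro exI conjI allI)
  let ?m = "\<lambda>s. (\<Prod>t\<in>{0..<s}. g t) / (\<Prod>t\<in>{s..<0}. g t)"
  show "?m s \<noteq> 0" for s
    using assms by simp
  show "?m (s + 1) = ?m s * g s" for s
  proof (cases "s \<ge> 0")
    case True
    then have "{0..<s + 1} = insert s {0..<s}"
      by auto
    with True show ?thesis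
      by simp
  next
    case False
    then have "{s..<0} = insert s {s + 1..<0}"
      by auto
    with False assms show ?thesis
      by (simp add: prod_zero_iff)
  qed
qed

lemma shift_invariant_axis:
  fixes f :: "int ^ 'n::finite \<Rightarrow> 'a"
  assumes "\<And>n. f (n + axis i 1) = f n"
  shows "f (n + axis i t) = f n"
proof (induction t rule: int_induct[where k = 0])
  case base
  then show ?case
    by (simp add: axis_def zero_vec_def[symmetric])
next
  case (step1 t)
  have "n + axis i (t + 1) = n + axis i t + axis i 1"
    by (simp add: vec_eq_iff axis_def)
  with step1 assms show ?case
    by metis
next
  case (step2 t)
  have "n + axis i t = n + axis i (t - 1) + axis i 1"
    by (simp add: vec_eq_iff axis_def)
  with step2 assms show ?case
    by metis
qed

lemma shift_invariant_cong:
  fixes f :: "int ^ 'n::finite \<Rightarrow> 'a"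
  assumes "\<And>i n. i \<in> J \<Longrightarrow> f (n + axis i 1) = f n"
    and "\<And>i. i \<notin> J \<Longrightarrow> n $ i = n' $ i"
  shows "f n = f n'"
  using finite[of J] assms
proof (induction J arbitrary: n rule: finite_induct)
  case empty
  then have "n = n'"
    by (simp add: vec_eq_iff)
  then show ?case
    by simp
next
  case (insert i J)
  \<comment> \<open>Coordinate \<open>i\<close> is moved to its value in \<open>n'\<close>, so that
    \<open>?n\<close> and \<open>n'\<close> can differ only at indices in the smaller set
    \<open>J\<close>.\<close>
  let ?n = "n + axis i (n' $ i - n $ i)"
  have "f ?n = f n"
    using insert.prems(1) by (rule shift_invariant_axis) simp
  moreover have "f ?n = f n'"
    using insert.prems by (intro insert.IH) (auto simp: axis_def)
  ultimately show ?case
    by simp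
qed

lemma split_product:
  fixes S :: "int ^ 'n::finite \<Rightarrow> 'a::field"
  assumes nz: "\<And>n. S n \<noteq> 0"
    and S: "\<And>i j n. i \<noteq> j \<Longrightarrow>
      S (n + axis i 1 + axis j 1) * S n = S (n + axis i 1) * S (n + axis j 1)"
  shows "\<exists>R c. (\<forall>i s. R i s \<noteq> 0) \<and> c \<noteq> 0 \<and> (\<forall>n. S n = (\<Prod>i\<in>UNIV. R i (n $ i)) * c)"
proof -
  define h where "h i n = S (n + axis i 1) / S n" for i n
  \<comment> \<open>Divided by \<open>S n * S (n + axis j 1)\<close>, the hypothesis says that
    \<open>h i\<close> is unchanged by shifts in every direction \<open>j\<close> other than
    \<open>i\<close>.\<close>
  have h: "h i n = h i (axis i (n $ i))" for i n
  proof (rule shift_invariant_cong[where J = "- {i}"])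
    fix j n assume "j \<in> - {i}"
    then have "S (n + axis i 1 + axis j 1) * S n = S (n + axis i 1) * S (n + axis j 1)"
      by (intro S) auto
    then show "h i (n + axis j 1) = h i n"
      using nz by (simp add: h_def field_simps add.commute add.left_commute)
  qed (auto simp: axis_def)
  have "\<exists>P. (\<forall>s. P s \<noteq> 0) \<and> (\<forall>s. P (s + 1) = P s * h i (axis i s))" for i
    by (rule exists_multiplicative_primitive) (simp add: h_def nz)
  then obtain R where R_nz: "\<And>i s. R i s \<noteq> 0"
    and R: "\<And>i s. R i (s + 1) = R i s * h i (axis i s)"
    by metis
  define P where "P n = (\<Prod>i\<in>UNIV. R i (n $ i))" for n :: "int ^ 'n"
  have P_nz: "P n \<noteq> 0" for n
    by (simp add: P_def R_nz)
  have P_shift: "P (n + axis i 1) = P n * h i n" for i n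
  proof -
    have "(\<Prod>j\<in>UNIV - {i}. R j ((n + axis i 1) $ j)) = (\<Prod>j\<in>UNIV - {i}. R j (n $ j))"
      by (intro prod.cong) (auto simp: axis_def)
    then have "P (n + axis i 1) = R i (n $ i + 1) * (\<Prod>j\<in>UNIV - {i}. R j (n $ j))"
      unfolding P_def by (subst prod.remove[of _ i]) (auto simp: axis_def)
    also have "\<dots> = P n * h i n"
      unfolding P_def by (subst (2) prod.remove[of _ i]) (auto simp: R h[of i n] mult_ac)
    finally show ?thesis .
  qed
  \<comment> \<open>A unit shift in direction \<open>i\<close> multiplies both \<open>S\<close> and
    \<open>P\<close> by \<open>h i n\<close>, so the quotient is constant.\<close>
  have "S n / P n = S 0 / P 0" for n
  proof (rule shift_invariant_cong[where J = UNIV and f = "\<lambda>n. S n / P n"])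
    show "S (n + axis i 1) / P (n + axis i 1) = S n / P n" for i n
      using nz P_nz[of n] by (simp add: P_shift h_def divide_simps)
  qed simp
  then have "S n = P n * (S 0 / P 0)" for n
    using P_nz[of n] by (metis nonzero_eq_divide_eq mult.commute)
  moreover have "S 0 / P 0 \<noteq> 0"
    using nz P_nz by simp
  ultimately show ?thesis
    using R_nz unfolding P_def by blast
qed

text \<open>This is the system at one lattice point for one pair of directions, with denominators
  cleared: \<open>a\<close>, \<open>b\<close>, \<open>c\<close> stand for the translates of
  \<open>r\<close> in direction \<open>i\<close>, \<open>j\<close> and both, and \<open>D\<close>
  for the difference \<open>a - b\<close>. Multiplying all \<open>K\<close> equations leaves the
  product of the \<open>D k\<close> on both sides.\<close>

lemma prod_cyclic_relation:
  fixes a b c r D :: "nat \<Rightarrow> 'a::field"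
  assumes "K \<ge> 1" and nz: "\<And>k. k \<in> {1..K} \<Longrightarrow> a k \<noteq> 0 \<and> b k \<noteq> 0 \<and> c k \<noteq> 0 \<and> r k \<noteq> 0"
    and step: "\<And>k. k \<in> {1..<K} \<Longrightarrow> D k * c k * r (Suc k) = D (Suc k) * a k * b k"
    and last: "D K * c K * r 1 = D 1 * a K * b K * q"
    and D: "\<exists>k\<in>{1..K}. D k \<noteq> 0"
  shows "(\<Prod>k=1..K. c k) * (\<Prod>k=1..K. r k) = (\<Prod>k=1..K. a k) * (\<Prod>k=1..K. b k) * q"
proof -
  \<comment> \<open>Each equation links \<open>D k\<close> and \<open>D (Suc k)\<close> through
    nonzero factors, so a single nonzero \<open>D k\<close> makes them all nonzero.\<close>
  have D_iff: "k \<le> K \<Longrightarrow> D k = 0 \<longleftrightarrow> D 1 = 0" if "k \<ge> 1" for k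
    using that
  proof (induction k rule: nat_induct_at_least)
    case (Suc k)
    then show ?case
      using step[of k] nz[of k] nz[of "Suc k"] by auto
  qed simp
  then have D_nz: "(\<Prod>k=1..K. D k) \<noteq> 0"
    using D by (metis atLeastAtMost_iff finite_atLeastAtMost prod_zero_iff)
  \<comment> \<open>The cyclic successor merges the two kinds of equation into one; being a
    permutation, it drops out of products over all \<open>k\<close>. The factor \<open>q\<close>
    enters only at the wrap-around \<open>k = K\<close>.\<close>
  define next_idx where "next_idx k = (if k = K then 1 else Suc k)" for k
  have bij: "bij_betw next_idx {1..K} {1..K}"
    using \<open>K \<ge> 1\<close>
    by (intro bij_betw_byWitness[where f' = "\<lambda>k. if k = 1 then K else k - 1"])
       (auto simp: next_idx_def)
  have "(\<Prod>k=1..K. D k * c k * r (next_idx k))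
      = (\<Prod>k=1..K. D (next_idx k) * a k * b k * (if k = K then q else 1))"
    using step last by (intro prod.cong) (auto simp: next_idx_def)
  then have "(\<Prod>k=1..K. D k) * (\<Prod>k=1..K. c k) * (\<Prod>k=1..K. r k)
      = (\<Prod>k=1..K. D k) * (\<Prod>k=1..K. a k) * (\<Prod>k=1..K. b k) * q"
    using \<open>K \<ge> 1\<close> unfolding prod.distrib prod.reindex_bij_betw[OF bij] by simp
  with D_nz show ?thesis
    by (simp add: mult.assoc)
qed

lemma nsigma_add_axis: "nsigma (n + axis i 1) = nsigma n + 1"
  by (simp add: nsigma_def axis_def sum.distrib)

text \<open>Since \<open>inverse b - inverse a = (a - b) / (a * b)\<close> in a field, clearing
  denominators brings the system into the cyclic form, with the ratio of \<mu> values as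
  \<open>q\<close>.\<close>

lemma prod_lmGD:
  fixes r :: "nat \<Rightarrow> int ^ 'n::finite \<Rightarrow> 'a::field"
  assumes "K \<ge> 1"
    and \<mu>: "\<And>s. \<mu>\<^sub>1 s \<noteq> 0"
    and r: "\<And>k n. k \<in> {1..K} \<Longrightarrow> r k n \<noteq> 0"
    and sys: "nonisospectral_lmGD K \<mu>\<^sub>1 r"
    and nondeg: "nondegenerate K r"
    and "i \<noteq> j"
  shows "(\<Prod>k=1..K. r k (n + axis i 1 + axis j 1)) * (\<Prod>k=1..K. r k n)
    = (\<Prod>k=1..K. r k (n + axis i 1)) * (\<Prod>k=1..K. r k (n + axis j 1))
      * (\<mu>\<^sub>1 (nsigma n + 1) / \<mu>\<^sub>1 (nsigma n))"
proof (rule prod_cyclic_relation[where D = "\<lambda>k. r k (n + axis i 1) - r k (n + axis j 1)"])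
  have commute: "n + axis j 1 + axis i 1 = n + axis i 1 + axis j 1"
    by (simp add: algebra_simps)
  note eqs = sys[unfolded nonisospectral_lmGD_def translate_def, rule_format, OF \<open>i \<noteq> j\<close>, of n,
    unfolded commute]
  show "(r k (n + axis i 1) - r k (n + axis j 1)) * r k (n + axis i 1 + axis j 1) * r (Suc k) n
      = (r (Suc k) (n + axis i 1) - r (Suc k) (n + axis j 1)) * r k (n + axis i 1) * r k (n + axis j 1)"
    if k: "k \<in> {1..<K}" for k
  proof -
    have "(inverse (r k (n + axis j 1)) - inverse (r k (n + axis i 1))) * r k (n + axis i 1 + axis j 1)
        = inverse (r (Suc k) n) * (r (Suc k) (n + axis i 1) - r (Suc k) (n + axis j 1))"
      using eqs k by simp
    moreover have "r k n' \<noteq> 0" "r (Suc k) n' \<noteq> 0" for n'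
      using r k by auto
    ultimately show ?thesis
      by (simp add: field_simps)
  qed
  have "(inverse (r K (n + axis j 1)) - inverse (r K (n + axis i 1))) * r K (n + axis i 1 + axis j 1)
      = inverse (\<mu>\<^sub>1 (nsigma n)) * inverse (r 1 n) * (r 1 (n + axis i 1) - r 1 (n + axis j 1))
        * \<mu>\<^sub>1 (nsigma n + 1)"
    using eqs by blast
  moreover have "r K n' \<noteq> 0" "r 1 n' \<noteq> 0" for n'
    using r \<open>K \<ge> 1\<close> by auto
  ultimately show "(r K (n + axis i 1) - r K (n + axis j 1)) * r K (n + axis i 1 + axis j 1) * r 1 n
      = (r 1 (n + axis i 1) - r 1 (n + axis j 1)) * r K (n + axis i 1) * r K (n + axis j 1)
        * (\<mu>\<^sub>1 (nsigma n + 1) / \<mu>\<^sub>1 (nsigma n))"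
    using \<mu> by (simp add: field_simps)
  show "\<exists>k\<in>{1..K}. r k (n + axis i 1) - r k (n + axis j 1) \<noteq> 0"
    using nondeg \<open>i \<noteq> j\<close> by (simp add: nondegenerate_def translate_def)
qed (use assms in auto)

theorem lemma4p4:
  fixes K :: nat
    and \<mu>\<^sub>1 :: "int \<Rightarrow> 'a::field"
    and r :: "nat \<Rightarrow> int ^ 'n \<Rightarrow> 'a"
  assumes "CARD('n) \<ge> 2"
    and "K \<ge> 1"
    and "\<forall>s. \<mu>\<^sub>1 s \<noteq> 0"
    and "\<forall>k\<in>{1..K}. \<forall>n. r k n \<noteq> 0"
    and "nonisospectral_lmGD K \<mu>\<^sub>1 r"
    and "nondegenerate K r"
  shows "\<exists>(R :: 'n \<Rightarrow> int \<Rightarrow> 'a) (m :: int \<Rightarrow> 'a).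
    (\<forall>i s. R i s \<noteq> 0) \<and> (\<forall>s. m s \<noteq> 0) \<and>
    (\<forall>n. (\<Prod>k=1..K. r k n) = (\<Prod>i\<in>UNIV. R i (n $ i)) * m (nsigma n))"
proof -
  obtain m where m_nz: "\<And>s. m s \<noteq> 0" and m: "\<And>s. m (s + 1) = m s * \<mu>\<^sub>1 s"
    using exists_multiplicative_primitive[of \<mu>\<^sub>1] assms(3) by blast
  define Q where "Q n = (\<Prod>k=1..K. r k n)" for n
  have Q_nz: "Q n \<noteq> 0" for n
    using assms(4) by (simp add: Q_def)
  \<comment> \<open>With \<open>s = nsigma n\<close>, the recurrence gives \<open>m (s + 2) * m s /
    (m (s + 1))^2 = \<mu>\<^sub>1 (s + 1) / \<mu>\<^sub>1 s\<close>, which is exactly the factor to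
    be removed from the relation for \<open>Q\<close>.\<close>
  define S where "S n = Q n / m (nsigma n)" for n
  have S_nz: "S n \<noteq> 0" for n
    by (simp add: S_def Q_nz m_nz)
  have "S (n + axis i 1 + axis j 1) * S n = S (n + axis i 1) * S (n + axis j 1)"
    if "i \<noteq> j" for i j n
  proof -
    have Q_shift: "Q (n + axis i 1 + axis j 1) * Q n
        = Q (n + axis i 1) * Q (n + axis j 1) * (\<mu>\<^sub>1 (nsigma n + 1) / \<mu>\<^sub>1 (nsigma n))"
      unfolding Q_def using assms that by (intro prod_lmGD) auto
    have S_shift: "S (n + axis l 1) = Q (n + axis l 1) / (m (nsigma n) * \<mu>\<^sub>1 (nsigma n))" for l
      by (simp add: S_def nsigma_add_axis m)
    have S_shift2: "S (n + axis i 1 + axis j 1) = Q (n + axis i 1 + axis j 1)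
        / (m (nsigma n) * \<mu>\<^sub>1 (nsigma n) * \<mu>\<^sub>1 (nsigma n + 1))"
      unfolding S_def nsigma_add_axis m by (rule refl)
    show ?thesis
      unfolding S_shift S_shift2 S_def[of n] using Q_shift m_nz[of "nsigma n"] assms(3)
      by (simp add: divide_simps mult_ac)
  qed
  from split_product[OF S_nz this] obtain R c where "\<And>i s. R i s \<noteq> 0" "c \<noteq> 0"
    and R: "\<And>n. S n = (\<Prod>i\<in>UNIV. R i (n $ i)) * c"
    by blast
  \<comment> \<open>The leftover constant \<open>c\<close> is absorbed into the function of
    \<open>nsigma n\<close>.\<close>
  moreover have "Q n = (\<Prod>i\<in>UNIV. R i (n $ i)) * (c * m (nsigma n))" for n
    using m_nz[of "nsigma n"] R[of n] unfolding S_def[of n]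
    by (simp add: nonzero_divide_eq_eq mult.assoc)
  ultimately show ?thesis
    using m_nz unfolding Q_def by (intro exI[of _ R] exI[of _ "\<lambda>s. c * m s"]) simp
qed

end
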